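(* Let $n\geq 1$. When $W$ is the symmetric group $S_{2n}$, $x_2^{-1}$ has the following probabilistic interpretation, i.e. it is the distribution of the result of the following shuffle of a deck of $2n$ cards. Step 1: Choose an even number $2j$ between $0$ and $2n$, with the probability of getting $2j$ equal to $\binom{2n}{2j}/2^{2n-1}$. From the stack of $2n$ cards, form a second pile of size $2j$ by removing the top $j$ cards of the stack, and then putting the bottom $j$ cards of the first stack on top of them. Step 2: Now one has a stack of size $2n-2j$ and a stack of size $2j$. Drop cards repeatedly according to the rule that if stacks $1,2$ have sizes $A,B$ at some time, then the next card comes from stack $1$ with probability $\frac{A}{A+B}$ and from stack $2$ with probability $\frac{B}{A+B}$. (Equivalently, choose uniformly at random one of the $\binom{2n}{2j}$ interleavings preserving the relative orders of the cards in each stack.) The description of $x_2^{-1}$ is the same for the symmetric group $S_{2n+1}$ (deck of $2n+1$ cards), except that in Step 1 the chance of getting $2j$ is $\binom{2n+1}{2j}/2^{2n}$ ($0\le 2j\le 2n$), and at the beginning of Step 2 one has a stack of size $2n+1-2j$ and a stack of size $2j$.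
   Context: Definition of $x_k$ (Cellini). Let $W$ be the Weyl group of an irreducible crystallographic root system of rank $r$ with simple roots $\Pi=\{\alpha_1,\dots,\alpha_r\}$, highest root $\theta$, and coroot lattice $Y$; put $\alpha_0=-\theta$ and $\tilde\Pi=\Pi\cup\{\alpha_0\}$. Let $Cdes(w)$ be the set of elements of $\tilde\Pi$ mapped to negative roots by $w$. For a positive integer $k$ and $I\subseteq\tilde\Pi$, let $a_{k,I}$ be the number of $t\in Y$ such that $\langle\alpha_i,t\rangle=0$ for all $\alpha_i\in I\cap\Pi$, $\langle\alpha_i,t\rangle>0$ for all $\alpha_i\in\Pi-I$, and moreover $\langle\theta,t\rangle=k$ if $\alpha_0\in I$, while $\langle\theta,t\rangle<k$ if $\alpha_0\notin I$. Then $x_k=\sum_{w\in W}\Big(\frac1{k^r}\sum_{I\subseteq\tilde\Pi-Cdes(w)}a_{k,I}\Big)w$, which defines a probability measure on $W$. For $W=S_N$ ($r=N-1$), $W$ acts by $w(e_i)=e_{w(i)}$, $\alpha_i=e_i-e_{i+1}$ ($1\le i\le N-1$), $\theta=e_1-e_N$, and $Y$ is the set of integer vectors in $\mathbb{Z}^N$ with coordinate sum $0$. $x_2^{-1}$ denotes the image of $x_2$ under the linear map of the group algebra sending each $w$ to $w^{-1}$. The deck initially has cards labelled $1,\dots,N$ from top to bottom; the shuffled deck is identified with the permutation $\pi$ for which $\pi(i)$ is the label of the card in position $i$ from the top after shuffling. Equivalently, $x_2$ is the distribution of the permutation sending each label to the final position of that card. Cards are dropped from the bottoms of the stacks, each dropped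 card being placed on top of the previously dropped cards. *)

theory Defs
  imports
    "HOL-Probability.Probability"
    "HOL-Combinatorics.Permutations"
    "HOL-Library.Function_Algebras"
begin

section \<open>Cellini's elements\<close>

text \<open>
  The field \<open>pairing\<close> is evaluated at a root and a point of the coroot lattice;
  \<open>pos_roots\<close> are the positive roots with respect to the simple roots \<open>simples\<close>.
  No axioms are imposed here; the type A datum used later is given explicitly.
\<close>

record ('w, 'v) weyl_datum =
  weyl :: "'w set"
  action :: "'w \<Rightarrow> 'v \<Rightarrow> 'v"
  pos_roots :: "'v set"
  simples :: "'v set"
  highest :: "'v"
  coroot_lattice :: "'v set"
  pairing :: "'v \<Rightarrow> 'v \<Rightarrow> int"

definition affine_root :: "('w, 'v::ab_group_add) weyl_datum \<Rightarrow> 'v" where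
  "affine_root D = - highest D"

definition ext_simples :: "('w, 'v::ab_group_add) weyl_datum \<Rightarrow> 'v set" where
  "ext_simples D = insert (affine_root D) (simples D)"

definition neg_roots :: "('w, 'v::ab_group_add) weyl_datum \<Rightarrow> 'v set" where
  "neg_roots D = uminus ` pos_roots D"

definition cdes :: "('w, 'v::ab_group_add) weyl_datum \<Rightarrow> 'w \<Rightarrow> 'v set" where
  "cdes D w = {\<alpha> \<in> ext_simples D. action D w \<alpha> \<in> neg_roots D}"

definition cellini_count :: "('w, 'v::ab_group_add) weyl_datum \<Rightarrow> nat \<Rightarrow> 'v set \<Rightarrow> nat" where
  "cellini_count D k I = card {t \<in> coroot_lattice D.
      (\<forall>\<alpha> \<in> I \<inter> simples D. pairing D \<alpha> t = 0) \<and>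
      (\<forall>\<alpha> \<in> simples D - I. pairing D \<alpha> t > 0) \<and>
      (if affine_root D \<in> I then pairing D (highest D) t = int k
       else pairing D (highest D) t < int k)}"

text \<open>
  Elements of the real group algebra are coefficient functions that vanish outside the group.
\<close>

definition cellini :: "('w, 'v::ab_group_add) weyl_datum \<Rightarrow> nat \<Rightarrow> 'w \<Rightarrow> real" where
  "cellini D k w =
     (if w \<in> weyl D
      then 1 / real k ^ card (simples D) *
             (\<Sum>I \<in> Pow (ext_simples D - cdes D w). real (cellini_count D k I))
      else 0)"

section \<open>The symmetric group\<close>

text \<open>
  Vectors of \<open>\<int>\<^sup>N\<close> are functions \<open>nat \<Rightarrow> int\<close> supported in \<open>{1..N}\<close>,
  with the pointwise group structure. Coroots are identified with vectors via the dot product.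
\<close>

definition unit_vec :: "nat \<Rightarrow> nat \<Rightarrow> int" where
  "unit_vec i = (\<lambda>j. if j = i then 1 else 0)"

definition perm_action :: "(nat \<Rightarrow> nat) \<Rightarrow> (nat \<Rightarrow> int) \<Rightarrow> (nat \<Rightarrow> int)" where
  "perm_action w v = (\<lambda>j. v (inv w j))"

lemma perm_action_unit_vec: "bij w \<Longrightarrow> perm_action w (unit_vec i) = unit_vec (w i)"
  by (auto simp: perm_action_def unit_vec_def fun_eq_iff bij_is_inj bij_is_surj surj_f_inv_f)

definition type_A :: "nat \<Rightarrow> (nat \<Rightarrow> nat, nat \<Rightarrow> int) weyl_datum" where
  "type_A N =
     \<lparr> weyl = {w. w permutes {1..N}},
       action = perm_action,
       pos_roots = {unit_vec i - unit_vec j | i j. 1 \<le> i \<and> i < j \<and> j \<le> N},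
       simples = {unit_vec i - unit_vec (i + 1) | i. 1 \<le> i \<and> i \<le> N - 1},
       highest = unit_vec 1 - unit_vec N,
       coroot_lattice = {t. (\<forall>i. i \<notin> {1..N} \<longrightarrow> t i = 0) \<and> (\<Sum>i\<in>{1..N}. t i) = 0},
       pairing = (\<lambda>v t. \<Sum>i\<in>{1..N}. v i * t i) \<rparr>"

text \<open>The linear extension of \<open>w \<mapsto> w\<^sup>-\<^sup>1\<close> to the group algebra.\<close>

definition group_algebra_inv ::
    "nat \<Rightarrow> ((nat \<Rightarrow> nat) \<Rightarrow> real) \<Rightarrow> (nat \<Rightarrow> nat) \<Rightarrow> real" where
  "group_algebra_inv N x w = (\<Sum>u \<in> {u. u permutes {1..N} \<and> inv u = w}. x u)"

section \<open>The shuffle\<close>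

text \<open>Decks and stacks are lists of labels, read from top to bottom.\<close>

definition initial_deck :: "nat \<Rightarrow> nat list" where
  "initial_deck N = [1..<N + 1]"

text \<open>
  The distribution of \<open>j\<close>, where \<open>2 j\<close> is the size of the second pile.
\<close>

definition pile_index_pmf :: "nat \<Rightarrow> nat pmf" where
  "pile_index_pmf N =
     embed_pmf (\<lambda>j. if 2 * j \<le> N then real (N choose (2 * j)) / 2 ^ (N - 1) else 0)"

lemma pmf_pile_index:
  assumes "N \<ge> 1"
  shows "pmf (pile_index_pmf N) j =
           (if 2 * j \<le> N then real (N choose (2 * j)) / 2 ^ (N - 1) else 0)"
  unfolding pile_index_pmf_def
proof (rule pmf_embed_pmf)
  let ?f = "\<lambda>j. if 2 * j \<le> N then real (N choose (2 * j)) / 2 ^ (N - 1) else 0"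
  let ?J = "{j. 2 * j \<le> N}"
  show "0 \<le> ?f j" for j by simp
  have fin: "finite ?J" by (rule finite_subset[of _ "{..N}"]) auto
  have "(\<Sum>i\<le>N. if even i then real (N choose i) else 0) =
        (\<Sum>i\<in>{i. i \<le> N \<and> even i}. real (N choose i))"
    by (subst sum.inter_filter [symmetric]) (auto intro!: sum.cong)
  also have "\<dots> = (\<Sum>j\<in>?J. real (N choose (2 * j)))"
    by (rule sum.reindex_bij_witness[of _ "\<lambda>j. 2 * j" "\<lambda>i. i div 2"]) auto
  finally have "2 * (\<Sum>j\<in>?J. real (N choose (2 * j))) = 2 ^ N"
    using choose_even_sum[of N, where 'a = real] assms by simp
  moreover have "(2::real) ^ N = 2 * 2 ^ (N - 1)"
    using assms by (metis Suc_diff_1 less_le_trans power_Suc zero_less_one)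
  ultimately have "(\<Sum>j\<in>?J. real (N choose (2 * j))) = 2 ^ (N - 1)" by simp
  hence one: "(\<Sum>j\<in>?J. ?f j) = 1" by (simp flip: sum_divide_distrib)
  have "(\<integral>\<^sup>+ j. ennreal (?f j) \<partial>count_space UNIV) = (\<Sum>j\<in>?J. ennreal (?f j))"
    by (rule nn_integral_count_space'[OF fin]) auto
  also have "\<dots> = ennreal (\<Sum>j\<in>?J. ?f j)" by (rule sum_ennreal) simp
  finally show "(\<integral>\<^sup>+ j. ennreal (?f j) \<partial>count_space UNIV) = 1" using one by simp
qed

text \<open>
  The second pile consists of the top \<open>j\<close> cards of the deck, with the block of the bottom
  \<open>j\<close> cards, in unchanged order, put on top of them.
\<close>

definition first_stack :: "nat list \<Rightarrow> nat \<Rightarrow> nat list" where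
  "first_stack deck j = drop j (take (length deck - j) deck)"

definition second_stack :: "nat list \<Rightarrow> nat \<Rightarrow> nat list" where
  "second_stack deck j = drop (length deck - j) deck @ take j deck"

text \<open>
  A state consists of the two stacks and the pile of cards dropped so far. The bottom card of
  the chosen stack goes on top of that pile.
\<close>

fun drop_card ::
    "nat list \<times> nat list \<times> nat list \<Rightarrow> (nat list \<times> nat list \<times> nat list) pmf" where
  "drop_card (xs, ys, pile) =
     map_pmf (\<lambda>from_first. if from_first
                then (butlast xs, ys, last xs # pile)
                else (xs, butlast ys, last ys # pile))
       (bernoulli_pmf (real (length xs) / (real (length xs) + real (length ys))))"

primrec drop_cards ::
    "nat \<Rightarrow> nat list \<times> nat list \<times> nat list \<Rightarrow> (nat list \<times> nat list \<times> nat list) pmf" where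
  "drop_cards 0 s = return_pmf s"
| "drop_cards (Suc m) s = bind_pmf (drop_card s) (drop_cards m)"

definition riffle_by_dropping :: "nat list \<Rightarrow> nat list \<Rightarrow> nat list pmf" where
  "riffle_by_dropping xs ys =
     map_pmf (\<lambda>(_, _, pile). pile) (drop_cards (length xs + length ys) (xs, ys, []))"

definition riffle_uniform :: "nat list \<Rightarrow> nat list \<Rightarrow> nat list pmf" where
  "riffle_uniform xs ys = pmf_of_set (shuffles xs ys)"

definition shuffle_pmf ::
    "(nat list \<Rightarrow> nat list \<Rightarrow> nat list pmf) \<Rightarrow> nat \<Rightarrow> nat list pmf" where
  "shuffle_pmf riffle N =
     bind_pmf (pile_index_pmf N) (\<lambda>j.
       riffle (first_stack (initial_deck N) j) (second_stack (initial_deck N) j))"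

text \<open>The permutation sending a position, counted from 1 at the top, to the label found there.\<close>

definition deck_perm :: "nat list \<Rightarrow> nat \<Rightarrow> nat" where
  "deck_perm deck i = (if i \<in> {1..length deck} then deck ! (i - 1) else i)"

definition shuffle_perm_pmf ::
    "(nat list \<Rightarrow> nat list \<Rightarrow> nat list pmf) \<Rightarrow> nat \<Rightarrow> (nat \<Rightarrow> nat) pmf" where
  "shuffle_perm_pmf riffle N = map_pmf deck_perm (shuffle_pmf riffle N)"

end

theory Submission
  imports Defs
begin

text \<open>
  Summing \<open>a\<^bsub>k,I\<^esub>\<close> over \<open>I \<subseteq> \<Pi> \<union> {\<alpha>\<^sub>0} - Cdes(w)\<close> counts the points \<open>t\<close> of the coroot lattice in the
  \<open>k\<close>-fold dilated fundamental alcove such that no wall through \<open>t\<close> belongs to \<open>Cdes(w)\<close>.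
  In type A with \<open>k = 2\<close> these points are
  \<open>t\<^sub>j = (1, \<dots>, 1, 0, \<dots>, 0, -1, \<dots>, -1)\<close> with \<open>j\<close> ones and \<open>j\<close> minus ones, \<open>0 \<le> 2 j \<le> N\<close>, and the
  condition on the walls through \<open>t\<^sub>j\<close> says that \<open>w\<close> is increasing along \<open>j + 1, \<dots>, N - j\<close> and along
  \<open>N - j + 1, \<dots>, N, 1, \<dots>, j\<close>. These are the two stacks of the shuffle, so for \<open>w = \<pi>\<^sup>-\<^sup>1\<close> the condition
  means that \<open>\<pi>\<close> is one of the \<open>N choose 2 j\<close> interleavings of the stacks; this binomial coefficient
  cancels against the probability of \<open>2 j\<close>.
\<close>

section \<open>Riffling two stacks\<close>

text \<open>Since the stacks share no card, each card of \<open>zs\<close> reveals its stack, and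
  filtering recovers both stacks. Conversely, every list is an interleaving of the two parts into
  which a predicate splits it.\<close>

lemma in_shuffles_iff_filter:
  assumes "set xs \<inter> set ys = {}"
  shows "zs \<in> shuffles xs ys \<longleftrightarrow>
    filter (\<lambda>z. z \<in> set xs) zs = xs \<and> filter (\<lambda>z. z \<notin> set xs) zs = ys"
    (is "_ \<longleftrightarrow> ?R")
proof
  assume "zs \<in> shuffles xs ys"
  thus ?R using filter_shuffles_disjoint1[OF assms] by blast
next
  assume ?R
  thus "zs \<in> shuffles xs ys"
    using partition_in_shuffles[of zs "\<lambda>z. z \<in> set xs"] by (elim conjE) (simp only:)
qed

lemma rev_in_shuffles_iff:
  assumes "set xs \<inter> set ys = {}"
  shows "rev zs \<in> shuffles (rev xs) (rev ys) \<longleftrightarrow> zs \<in> shuffles xs ys"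
proof -
  have "set (rev xs) \<inter> set (rev ys) = {}" using assms by simp
  thus ?thesis
    by (simp only: in_shuffles_iff_filter[OF assms] in_shuffles_iff_filter[of "rev xs" "rev ys"]
        set_rev rev_filter[symmetric] rev_is_rev_conv)
qed

text \<open>The standard recursion for \<open>shuffles\<close> splits off the first entry, whereas
  cards are dropped from the bottom. Reversing all three lists turns that recursion into one on the
  last entry.\<close>

lemma snoc_in_shuffles_iff:
  assumes "set xs \<inter> set ys = {}"
  shows "zs @ [z] \<in> shuffles xs ys \<longleftrightarrow>
    xs \<noteq> [] \<and> last xs = z \<and> zs \<in> shuffles (butlast xs) ys \<or>
    ys \<noteq> [] \<and> last ys = z \<and> zs \<in> shuffles xs (butlast ys)"
proof -
  have tl_rev: "tl (rev l) = rev (butlast l)" for l :: "'a list"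
    by (cases l rule: rev_cases) simp_all
  have 1: "set (butlast xs) \<inter> set ys = {}" "set xs \<inter> set (butlast ys) = {}"
    using assms by (auto dest: in_set_butlastD)
  have "zs @ [z] \<in> shuffles xs ys \<longleftrightarrow> z # rev zs \<in> shuffles (rev xs) (rev ys)"
    using rev_in_shuffles_iff[OF assms, of "zs @ [z]"] by simp
  also have "\<dots> \<longleftrightarrow> xs \<noteq> [] \<and> last xs = z \<and> rev zs \<in> shuffles (rev (butlast xs)) (rev ys) \<or>
    ys \<noteq> [] \<and> last ys = z \<and> rev zs \<in> shuffles (rev xs) (rev (butlast ys))"
    by (simp only: Cons_in_shuffles_iff hd_rev tl_rev rev_is_Nil_conv)
  finally show ?thesis
    by (simp add: rev_in_shuffles_iff 1)
qed

lemma shuffles_eq_last_Un: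
  assumes "set xs \<inter> set ys = {}" "xs \<noteq> []" "ys \<noteq> []"
  shows "shuffles xs ys = (\<lambda>zs. zs @ [last xs]) ` shuffles (butlast xs) ys \<union>
    (\<lambda>zs. zs @ [last ys]) ` shuffles xs (butlast ys)"
proof (intro set_eqI)
  fix zs
  show "zs \<in> shuffles xs ys \<longleftrightarrow> zs \<in> (\<lambda>zs. zs @ [last xs]) ` shuffles (butlast xs) ys \<union>
    (\<lambda>zs. zs @ [last ys]) ` shuffles xs (butlast ys)"
    using assms(2,3) by (cases zs rule: rev_cases) (auto simp: snoc_in_shuffles_iff[OF assms(1)])
qed

section \<open>The dropping rule and uniform interleavings\<close>

lemma pmf_of_set_disjoint_Un:
  assumes "finite A" "finite B" "A \<inter> B = {}" "A \<noteq> {}" "B \<noteq> {}"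
  shows "pmf_of_set (A \<union> B) =
    bind_pmf (bernoulli_pmf (card A / (card A + card B))) (\<lambda>b. pmf_of_set (if b then A else B))"
proof (rule pmf_eqI)
  fix x
  have pos: "card A > 0" "card B > 0"
    using assms by (auto simp: card_gt_0_iff)
  hence "1 - real (card A) / (card A + card B) = card B / (card A + card B)"
    by (simp add: field_simps)
  moreover have "pmf (bind_pmf (bernoulli_pmf p) (\<lambda>b. pmf_of_set (if b then A else B))) x =
      p * (indicator A x / card A) + (1 - p) * (indicator B x / card B)"
    if "0 \<le> p" "p \<le> 1" for p
    using assms that by (simp add: pmf_bind mult.commute)
  moreover have "0 \<le> real (card A) / (card A + card B)" "real (card A) / (card A + card B) \<le> 1"
    using pos by simp_all
  moreover have "indicator (A \<union> B) x = (indicator A x + indicator B x :: real)"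
    using assms(3) by (auto simp: indicator_def)
  \<comment> \<open>Weighting by size cancels the size: a point of \<open>A\<close> gets
    \<open>card A / (card A + card B)\<close> times \<open>1 / card A\<close>, and likewise for
    \<open>B\<close>.\<close>
  ultimately show "pmf (pmf_of_set (A \<union> B)) x =
    pmf (bind_pmf (bernoulli_pmf (card A / (card A + card B)))
      (\<lambda>b. pmf_of_set (if b then A else B))) x"
    using assms pos by (simp add: card_Un_disjoint add_divide_distrib)
qed

lemma map_pmf_snoc_shuffles:
  "map_pmf (\<lambda>zs. zs @ [z]) (pmf_of_set (shuffles xs ys)) =
    pmf_of_set ((\<lambda>zs. zs @ [z]) ` shuffles xs ys)"
  by (rule map_pmf_of_set_inj) (auto simp: inj_on_def)

text \<open>Interleavings are split by the stack that supplies the bottom card. With stacks of sizes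
  A and B, the two classes have sizes binomial(A+B-1, A-1) and binomial(A+B-1, A), whose ratio is A
  : B; this is exactly the bias of the dropping rule.\<close>

lemma pmf_of_set_shuffles_last:
  assumes "set xs \<inter> set ys = {}" "xs \<noteq> [] \<or> ys \<noteq> []"
  shows "pmf_of_set (shuffles xs ys) =
    bind_pmf (bernoulli_pmf (real (length xs) / (real (length xs) + real (length ys))))
      (\<lambda>b. if b then map_pmf (\<lambda>zs. zs @ [last xs]) (pmf_of_set (shuffles (butlast xs) ys))
           else map_pmf (\<lambda>zs. zs @ [last ys]) (pmf_of_set (shuffles xs (butlast ys))))"
proof -
  \<comment> \<open>If one stack is empty, the coin is deterministic and only one interleaving
    exists.\<close>
  have bern: "bernoulli_pmf 0 = return_pmf False" "bernoulli_pmf 1 = return_pmf True"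
    by (rule pmf_eqI, case_tac i, simp_all)+
  consider "xs = []" | "ys = []" "xs \<noteq> []" | "xs \<noteq> []" "ys \<noteq> []" by blast
  thus ?thesis
  proof cases
    case 1
    thus ?thesis using assms(2)
      by (simp add: bern bind_return_pmf pmf_of_set_singleton)
  next
    case 2
    thus ?thesis
      by (simp add: bern bind_return_pmf pmf_of_set_singleton)
  next
    case 3
    let ?a = "length xs" and ?b = "length ys"
    let ?A = "(\<lambda>zs. zs @ [last xs]) ` shuffles (butlast xs) ys"
    let ?B = "(\<lambda>zs. zs @ [last ys]) ` shuffles xs (butlast ys)"
    have disj: "set (butlast xs) \<inter> set ys = {}" "set xs \<inter> set (butlast ys) = {}"
      using assms(1) by (auto dest: in_set_butlastD)
    \<comment> \<open>The last entries \<open>last xs\<close> and \<open>last ys\<close> differ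
      because the stacks are disjoint.\<close>
    have AB: "?A \<inter> ?B = {}"
      using 3 assms(1) last_in_set[of xs] last_in_set[of ys] by fastforce
    obtain a b where ab: "?a = Suc a" "?b = Suc b"
      using 3 by (metis length_0_conv not0_implies_Suc)
    have cA: "card ?A = (a + Suc b) choose a" and cB: "card ?B = (a + Suc b) choose Suc a"
      using ab disj by (auto simp: card_image inj_on_def card_disjoint_shuffles)
    have "Suc a * card ?B = Suc b * card ?A"
      unfolding cA cB using binomial_absorb_comp[of "a + Suc b" a]
      by (metis Suc_times_binomial_add add_Suc_right add_Suc_shift mult.commute)
    hence "real (Suc a) * card ?B = real (Suc b) * card ?A"
      by (metis of_nat_mult)
    moreover have "card ?A > 0" unfolding cA by simp
    moreover have "card ?B > 0" unfolding cB by simp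
    ultimately have p: "real (card ?A) / (card ?A + card ?B) = ?a / (?a + ?b)"
      by (simp add: ab field_simps)
    have "pmf_of_set (shuffles xs ys) = pmf_of_set (?A \<union> ?B)"
      using shuffles_eq_last_Un[OF assms(1)] 3 by simp
    also have "\<dots> = bind_pmf (bernoulli_pmf (card ?A / (card ?A + card ?B)))
        (\<lambda>b. pmf_of_set (if b then ?A else ?B))"
      by (rule pmf_of_set_disjoint_Un) (use AB in auto)
    also have "(\<lambda>b. pmf_of_set (if b then ?A else ?B)) =
      (\<lambda>b. if b then map_pmf (\<lambda>zs. zs @ [last xs]) (pmf_of_set (shuffles (butlast xs) ys))
           else map_pmf (\<lambda>zs. zs @ [last ys]) (pmf_of_set (shuffles xs (butlast ys))))"
      by (auto simp: map_pmf_snoc_shuffles)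
    finally show ?thesis unfolding p by simp
  qed
qed

text \<open>By induction on the number of cards left, peeling off the bottom card of a uniform
  interleaving at each drop. The pile must be arbitrary: dropped cards go on top of it, so it stays
  at the end of the final deck.\<close>

lemma drop_cards_pile:
  assumes "set xs \<inter> set ys = {}" "length xs + length ys = m"
  shows "map_pmf (\<lambda>(_, _, pile). pile) (drop_cards m (xs, ys, pile)) =
    map_pmf (\<lambda>zs. zs @ pile) (pmf_of_set (shuffles xs ys))"
  using assms
proof (induction m arbitrary: xs ys pile)
  case 0
  thus ?case by (simp add: pmf_of_set_singleton)
next
  case (Suc m)
  let ?a = "length xs" and ?b = "length ys"
  have disj: "set (butlast xs) \<inter> set ys = {}" "set xs \<inter> set (butlast ys) = {}"
    using Suc.prems(1) by (auto dest: in_set_butlastD)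
  let ?F = "\<lambda>b. map_pmf (\<lambda>(_, _, pile). pile) (drop_cards m
      (if b then (butlast xs, ys, last xs # pile) else (xs, butlast ys, last ys # pile)))"
  let ?G = "\<lambda>b. map_pmf (\<lambda>zs. zs @ pile)
      (if b then map_pmf (\<lambda>zs. zs @ [last xs]) (pmf_of_set (shuffles (butlast xs) ys))
       else map_pmf (\<lambda>zs. zs @ [last ys]) (pmf_of_set (shuffles xs (butlast ys))))"
  let ?p = "bernoulli_pmf (real ?a / (real ?a + real ?b))"
  \<comment> \<open>Only outcomes of positive probability are compared: drawing from an empty stack
    would leave the number of remaining cards at \<open>Suc m\<close>, and the induction hypothesis
    would not apply.\<close>
  have "?F b = ?G b" if "b \<in> set_pmf ?p" for b
  proof (cases b)
    case True
    have "xs \<noteq> []"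
    proof
      assume "xs = []"
      hence "pmf ?p True = 0" by simp
      thus False using that True by (simp add: set_pmf_eq)
    qed
    hence "length (butlast xs) + length ys = m"
      using Suc.prems(2) by (cases xs rule: rev_cases) auto
    thus ?thesis using True Suc.IH[OF disj(1)] by (simp add: pmf.map_comp o_def)
  next
    case False
    have "ys \<noteq> []"
    proof
      assume "ys = []"
      \<comment> \<open>All \<open>Suc m\<close> cards lie in \<open>xs\<close>, so the quotient is
        1. Two empty stacks would instead give \<open>0 / 0 = 0\<close> and outcome
        \<open>False\<close>.\<close>
      hence "pmf ?p False = 0" using Suc.prems by simp
      thus False using that False by (simp add: set_pmf_eq)
    qed
    hence "length xs + length (butlast ys) = m"
      using Suc.prems(2) by (cases ys rule: rev_cases) auto
    thus ?thesis using False Suc.IH[OF disj(2)] by (simp add: pmf.map_comp o_def)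
  qed
  hence "bind_pmf ?p ?F = bind_pmf ?p ?G"
    by (intro bind_pmf_cong) auto
  moreover have "xs \<noteq> [] \<or> ys \<noteq> []" using Suc.prems by auto
  ultimately show ?case
    by (simp add: pmf_of_set_shuffles_last[OF Suc.prems(1)] map_bind_pmf bind_map_pmf)
qed

lemma riffle_by_dropping_eq_uniform:
  assumes "set xs \<inter> set ys = {}"
  shows "riffle_by_dropping xs ys = riffle_uniform xs ys"
  using drop_cards_pile[OF assms refl, of "[]"]
  by (simp add: riffle_by_dropping_def riffle_uniform_def)

text \<open>For the deck listed by \<open>u\<close>, \<open>inv u\<close> sends a label to its
  position. The filtered deck has increasing positions and the same labels as \<open>xs\<close>, and
  a strictly increasing list is determined by its set of entries.\<close>

lemma filter_eq_iff_sorted_positions: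
  assumes "u permutes {1..N}" "set xs \<subseteq> {1..N}"
  shows "filter (\<lambda>z. z \<in> set xs) (map u [1..<N + 1]) = xs \<longleftrightarrow>
    sorted_wrt (<) (map (inv u) xs)"
proof -
  define D where "D = map u [1..<N + 1]"
  define F where "F = filter (\<lambda>z. z \<in> set xs) D"
  have inj: "inj u" "inj (inv u)"
    by (rule permutes_inj[OF assms(1)], rule permutes_inj[OF permutes_inv[OF assms(1)]])
  have "u ` {1..N} = {1..N}" using assms(1) by (rule permutes_image)
  hence "set D = {1..N}" by (simp add: D_def atLeastLessThanSuc_atLeastAtMost del: upt_Suc)
  hence set_F: "set F = set xs" using assms(2) by (auto simp: F_def)
  have "map (inv u) D = [1..<N + 1]"
    unfolding D_def map_map inv_o_cancel[OF inj(1)] list.map_id ..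
  hence "sorted_wrt (<) (map (inv u) D)" by (simp only: sorted_wrt_upt)
  hence F: "sorted_wrt (<) (map (inv u) F)"
    by (simp add: F_def sorted_wrt_map sorted_wrt_filter del: upt_Suc)
  have "F = xs \<longleftrightarrow> sorted_wrt (<) (map (inv u) xs)"
  proof
    assume "F = xs"
    thus "sorted_wrt (<) (map (inv u) xs)" using F by simp
  next
    assume X: "sorted_wrt (<) (map (inv u) xs)"
    have "map (inv u) F = map (inv u) xs"
      by (rule strict_sorted_equal[OF X F]) (simp add: set_F)
    thus "F = xs" using inj(2) by (simp add: inj_map_eq_map)
  qed
  thus ?thesis unfolding F_def D_def .
qed

section \<open>Lattice points of the dilated alcove\<close>

text \<open>The walls of the dilated alcove through \<open>t\<close>, each named by its element of
  \<open>ext_simples\<close>; \<open>\<alpha>\<^sub>0\<close> stands for the wall on which the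
  highest root takes the value \<open>k\<close>.\<close>

definition tight_roots :: "('w, 'v::ab_group_add) weyl_datum \<Rightarrow> nat \<Rightarrow> 'v \<Rightarrow> 'v set" where
  "tight_roots D k t = {\<alpha> \<in> simples D. pairing D \<alpha> t = 0} \<union>
     (if pairing D (highest D) t = int k then {affine_root D} else {})"

definition alcove_points :: "('w, 'v::ab_group_add) weyl_datum \<Rightarrow> nat \<Rightarrow> 'v set" where
  "alcove_points D k = {t \<in> coroot_lattice D.
     (\<forall>\<alpha> \<in> simples D. pairing D \<alpha> t \<ge> 0) \<and> pairing D (highest D) t \<le> int k}"

text \<open>The equalities and strict inequalities indexed by \<open>I\<close> together say that
  \<open>t\<close> lies in the closed dilated alcove and that \<open>I\<close> is exactly its set of
  walls. As \<open>\<alpha>\<^sub>0\<close> is not simple, the conditions on simple roots and on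
  \<open>\<alpha>\<^sub>0\<close> can be read off from \<open>I\<close> separately.\<close>

lemma cellini_count_eq:
  assumes "affine_root D \<notin> simples D" "I \<subseteq> ext_simples D"
  shows "cellini_count D k I = card {t \<in> alcove_points D k. tight_roots D k t = I}"
proof -
  have "(\<forall>\<alpha> \<in> I \<inter> simples D. pairing D \<alpha> t = 0) \<and> (\<forall>\<alpha> \<in> simples D - I. pairing D \<alpha> t > 0) \<and>
      (if affine_root D \<in> I then pairing D (highest D) t = int k
       else pairing D (highest D) t < int k) \<longleftrightarrow>
    (\<forall>\<alpha> \<in> simples D. pairing D \<alpha> t \<ge> 0) \<and> pairing D (highest D) t \<le> int k \<and>
      tight_roots D k t = I" (is "?L \<longleftrightarrow> ?R") for t
  proof
    assume L: ?L
    have "pairing D \<alpha> t \<ge> 0" if "\<alpha> \<in> simples D" for \<alpha>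
      using L that by (cases "\<alpha> \<in> I") (auto intro: less_imp_le)
    moreover have "tight_roots D k t = I"
    proof (rule set_eqI)
      fix \<alpha>
      show "\<alpha> \<in> tight_roots D k t \<longleftrightarrow> \<alpha> \<in> I"
      proof (cases "\<alpha> \<in> simples D")
        case True
        hence "pairing D \<alpha> t = 0 \<longleftrightarrow> \<alpha> \<in> I" using L by force
        thus ?thesis using True assms(1) by (auto simp: tight_roots_def)
      next
        case False
        thus ?thesis using L assms(2)
          by (cases "\<alpha> = affine_root D") (auto simp: tight_roots_def ext_simples_def split: if_splits)
      qed
    qed
    moreover have "pairing D (highest D) t \<le> int k"
      using L by (auto split: if_splits)
    ultimately show ?R by blast
  next
    assume R: ?R
    hence "tight_roots D k t = I" by blast
    hence "\<alpha> \<in> I \<longleftrightarrow> pairing D \<alpha> t = 0" if "\<alpha> \<in> simples D" for \<alpha>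
      using that assms(1) by (auto simp: tight_roots_def split: if_splits)
    moreover have "affine_root D \<in> I \<longleftrightarrow> pairing D (highest D) t = int k"
      using R assms(1) by (auto simp: tight_roots_def split: if_splits)
    ultimately show ?L using R by (auto simp: order.strict_iff_order)
  qed
  thus ?thesis
    unfolding cellini_count_def alcove_points_def by (intro arg_cong[where f = card]) blast
qed

text \<open>Each alcove point has one wall set, so the points counted for different \<open>I\<close>
  are disjoint, and their union over the \<open>I\<close> avoiding \<open>C\<close> consists of the
  points with no wall in \<open>C\<close>.\<close>

lemma sum_cellini_count:
  assumes "affine_root D \<notin> simples D" "finite (simples D)" "finite (alcove_points D k)"
  shows "(\<Sum>I \<in> Pow (ext_simples D - C). cellini_count D k I) =
    card {t \<in> alcove_points D k. tight_roots D k t \<inter> C = {}}"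
proof -
  let ?A = "\<lambda>I. {t \<in> alcove_points D k. tight_roots D k t = I}"
  let ?P = "Pow (ext_simples D - C)"
  have ext: "tight_roots D k t \<subseteq> ext_simples D" for t
    by (auto simp: tight_roots_def ext_simples_def)
  have "(\<Sum>I \<in> ?P. cellini_count D k I) = (\<Sum>I \<in> ?P. card (?A I))"
    by (intro sum.cong refl cellini_count_eq assms(1)) auto
  also have "\<dots> = card (\<Union>I \<in> ?P. ?A I)"
    by (rule card_UN_disjoint[symmetric]) (use assms in \<open>auto simp: ext_simples_def\<close>)
  also have "(\<Union>I \<in> ?P. ?A I) = {t \<in> alcove_points D k. tight_roots D k t \<inter> C = {}}"
    using ext by blast
  finally show ?thesis .
qed

section \<open>Roots, pairing and group action in type A\<close>

definition coord_root :: "nat \<Rightarrow> nat \<Rightarrow> nat \<Rightarrow> int" where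
  "coord_root i j = unit_vec i - unit_vec j"

text \<open>For \<open>a \<noteq> b\<close> the value 1 occurs only at \<open>a\<close> and the
  value -1 only at \<open>b\<close>, so the vector determines both indices.\<close>

lemma coord_root_eq_iff: "a \<noteq> b \<Longrightarrow> coord_root a b = coord_root c d \<longleftrightarrow> a = c \<and> b = d"
  by (auto simp: coord_root_def unit_vec_def fun_eq_iff split: if_splits)

lemma uminus_coord_root: "- coord_root a b = coord_root b a"
  by (simp add: coord_root_def)

lemma perm_action_coord_root:
  assumes "bij w"
  shows "perm_action w (coord_root a b) = coord_root (w a) (w b)"
proof -
  have "perm_action w (coord_root a b) = perm_action w (unit_vec a) - perm_action w (unit_vec b)"
    by (simp add: coord_root_def perm_action_def fun_eq_iff)
  thus ?thesis using assms by (simp add: perm_action_unit_vec coord_root_def)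
qed

lemma pairing_coord_root:
  assumes "a \<in> {1..N}" "b \<in> {1..N}"
  shows "pairing (type_A N) (coord_root a b) t = t a - t b"
proof -
  have "pairing (type_A N) (coord_root a b) t =
      (\<Sum>i\<in>{1..N}. if i = a then t i else 0) - (\<Sum>i\<in>{1..N}. if i = b then t i else 0)"
    unfolding sum_subtractf[symmetric]
    by (auto simp: type_A_def coord_root_def unit_vec_def intro!: sum.cong)
  thus ?thesis using assms by simp
qed

lemma simples_type_A: "simples (type_A N) = (\<lambda>i. coord_root i (i + 1)) ` {1..<N}"
  by (auto simp: type_A_def coord_root_def setcompr_eq_image intro!: image_cong)

lemma highest_type_A: "highest (type_A N) = coord_root 1 N"
  by (simp add: type_A_def coord_root_def)

lemma affine_root_type_A: "affine_root (type_A N) = coord_root N 1"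
  by (simp add: affine_root_def highest_type_A uminus_coord_root)

lemma card_simples_type_A: "card (simples (type_A N)) = N - 1"
proof -
  have "inj_on (\<lambda>i. coord_root i (i + 1)) {1..<N}"
    by (auto simp: inj_on_def coord_root_eq_iff)
  thus ?thesis by (simp add: simples_type_A card_image)
qed

lemma affine_root_notin_simples_type_A: "N \<ge> 2 \<Longrightarrow> affine_root (type_A N) \<notin> simples (type_A N)"
  by (auto simp: affine_root_type_A simples_type_A coord_root_eq_iff)

text \<open>A permutation acts on the indices of a root, and a root is negative when its first index
  is the larger one. Besides the simple roots this covers \<open>\<alpha>\<^sub>0\<close>, with
  \<open>a = N\<close> and \<open>b = 1\<close>.\<close>

lemma action_coord_root_negative_iff:
  assumes "w permutes {1..N}" "a \<in> {1..N}" "b \<in> {1..N}" "a \<noteq> b"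
  shows "action (type_A N) w (coord_root a b) \<in> neg_roots (type_A N) \<longleftrightarrow> w b < w a"
proof -
  have neg: "neg_roots (type_A N) = {coord_root j i | i j. 1 \<le> i \<and> i < j \<and> j \<le> N}"
    by (auto simp: neg_roots_def type_A_def coord_root_def image_iff) (metis minus_diff_eq)+
  have "w a \<noteq> w b"
    using permutes_inj[OF assms(1)] assms(4) by (simp add: inj_eq)
  moreover have "w a \<in> {1..N}" "w b \<in> {1..N}"
    using assms(2,3) by (simp_all only: permutes_in_image[OF assms(1)])
  moreover have "action (type_A N) w (coord_root a b) = coord_root (w a) (w b)"
    using assms(1) by (simp add: type_A_def perm_action_coord_root permutes_bij)
  ultimately show ?thesis by (auto simp: neg coord_root_eq_iff)
qed

section \<open>The lattice points for \<open>k = 2\<close>\<close>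

definition alcove_point :: "nat \<Rightarrow> nat \<Rightarrow> nat \<Rightarrow> int" where
  "alcove_point N j = (\<lambda>i. of_bool (1 \<le> i \<and> i \<le> j) - of_bool (N - j < i \<and> i \<le> N))"

lemma alcove_points_type_A:
  assumes "N \<ge> 1"
  shows "alcove_points (type_A N) k = {t. (\<forall>i. i \<notin> {1..N} \<longrightarrow> t i = 0) \<and> (\<Sum>i\<in>{1..N}. t i) = 0 \<and>
    (\<forall>i\<in>{1..<N}. t (Suc i) \<le> t i) \<and> t 1 - t N \<le> int k}"
  using assms
  by (auto simp: alcove_points_def simples_type_A highest_type_A pairing_coord_root) 
     (auto simp: type_A_def)

lemma atLeast1_down_closed:
  assumes "S \<subseteq> {1..N}" "\<And>i j. \<lbrakk>j \<in> S; 1 \<le> i; i \<le> j\<rbrakk> \<Longrightarrow> i \<in> S"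
  shows "S = {1..card S}"
proof (cases "S = {}")
  case False
  have fin: "finite S" using assms(1) finite_subset by blast
  have "S = {1..Max S}"
  proof (intro equalityI subsetI)
    fix i assume "i \<in> S"
    thus "i \<in> {1..Max S}" using assms(1) Max_ge[OF fin] by auto
  next
    fix i assume "i \<in> {1..Max S}"
    thus "i \<in> S" using assms(2)[OF Max_in[OF fin False]] by simp
  qed
  thus ?thesis by (metis card_atLeastAtMost diff_Suc_1)
qed auto

lemma sum_of_bool_mem_eq:
  "finite S \<Longrightarrow> (\<Sum>i\<in>S. of_bool (i \<in> A)) = int (card (S \<inter> A))"
  by (simp add: of_bool_def sum.If_cases)

text \<open>The coordinates decrease weakly, have sum 0 and spread at most 2, which confines them to
  -1, 0, 1. The zero sum balances the ones and the minus ones, and monotonicity puts them at the two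
  ends.\<close>

lemma alcove_points_type_A_2:
  assumes "N \<ge> 2"
  shows "alcove_points (type_A N) 2 = alcove_point N ` {j. 2 * j \<le> N}"
proof (intro equalityI subsetI)
  fix t assume "t \<in> alcove_points (type_A N) 2"
  hence supp: "\<And>i. i \<notin> {1..N} \<Longrightarrow> t i = 0" and sum0: "(\<Sum>i\<in>{1..N}. t i) = 0"
    and step_le: "\<And>i. i \<in> {1..<N} \<Longrightarrow> t (Suc i) \<le> t i" and diff: "t 1 - t N \<le> 2"
    using assms by (auto simp: alcove_points_type_A)
  have mono: "t j \<le> t i" if "1 \<le> i" "i \<le> j" "j \<le> N" for i j
    using that(2,3)
  proof (induction j rule: dec_induct)
    case (step m)
    thus ?case using step_le[of m] that(1) by force
  qed simp
  \<comment> \<open>If \<open>t 1\<close> were at least 2, the spread would make \<open>t N\<close>,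
    hence every coordinate, nonnegative, and the sum would be positive. The bound on
    \<open>t N\<close> is symmetric.\<close>
  have "t 1 \<le> 1"
  proof (rule ccontr)
    assume "\<not> t 1 \<le> 1"
    hence "t 1 > 0" "\<And>i. i \<in> {1..N} \<Longrightarrow> t i \<ge> 0"
      using diff mono[of _ N] by force+
    hence "(\<Sum>i\<in>{1..N}. t i) > 0" using assms by (intro sum_pos2[of _ 1]) auto
    thus False using sum0 by simp
  qed
  have "t N \<ge> -1"
  proof (rule ccontr)
    assume "\<not> t N \<ge> -1"
    hence "- t N > 0" "\<And>i. i \<in> {1..N} \<Longrightarrow> - t i \<ge> 0"
      using diff mono[of 1] by force+
    hence "(\<Sum>i\<in>{1..N}. - t i) > 0" using assms by (intro sum_pos2[of _ N]) auto
    thus False using sum0 by (simp add: sum_negf)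
  qed
  have range: "t i \<in> {-1, 0, 1}" if "i \<in> {1..N}" for i
    using mono[of 1 i] mono[of i N] that \<open>t 1 \<le> 1\<close> \<open>t N \<ge> -1\<close> by auto
  define P where "P = {i \<in> {1..N}. t i = 1}"
  define M where "M = {i \<in> {1..N}. t i = -1}"
  define j where "j = card P"
  have fin: "finite P" "finite M" by (simp_all add: P_def M_def)
  have "(\<Sum>i\<in>{1..N}. t i) = (\<Sum>i\<in>{1..N}. of_bool (i \<in> P) - of_bool (i \<in> M))"
    using range by (intro sum.cong) (auto simp: P_def M_def)
  also have "\<dots> = int (card ({1..N} \<inter> P)) - int (card ({1..N} \<inter> M))"
    by (simp only: sum_subtractf sum_of_bool_mem_eq finite_atLeastAtMost)
  also have "{1..N} \<inter> P = P" by (auto simp: P_def)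
  also have "{1..N} \<inter> M = M" by (auto simp: M_def)
  finally have cM: "card M = j" using sum0 by (simp add: j_def)
  have P: "P = {1..j}"
    unfolding j_def
  proof (rule atLeast1_down_closed[of _ N])
    fix a b assume "b \<in> P" "1 \<le> a" "a \<le> b"
    thus "a \<in> P" using mono[of a b] range[of a] by (auto simp: P_def)
  qed (auto simp: P_def)
  \<comment> \<open>The minus ones form a final segment; the reflection of \<open>{1..N}\<close>
    makes it an initial one, so that \<open>atLeast1_down_closed\<close> applies again.\<close>
  define M' where "M' = (\<lambda>i. N + 1 - i) ` M"
  have "card M' = j"
    unfolding M'_def using cM by (subst card_image) (auto simp: inj_on_def M_def)
  moreover have "M' = {1..card M'}"
  proof (rule atLeast1_down_closed[of _ N])
    fix a b assume "b \<in> M'" "1 \<le> a" "a \<le> b"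
    then obtain c where c: "c \<in> M" "b = N + 1 - c" by (auto simp: M'_def)
    hence "N + 1 - a \<in> {1..N}" "c \<le> N + 1 - a"
      using \<open>1 \<le> a\<close> \<open>a \<le> b\<close> by (auto simp: M_def)
    hence "N + 1 - a \<in> M"
      using mono[of c "N + 1 - a"] range[of "N + 1 - a"] c(1) by (auto simp: M_def)
    moreover have "a = N + 1 - (N + 1 - a)"
      using \<open>a \<le> b\<close> c by (auto simp: M_def)
    ultimately show "a \<in> M'" unfolding M'_def by blast
  qed (auto simp: M'_def M_def)
  ultimately have M': "M' = {1..j}" by simp
  have "P \<subseteq> {1..N}" by (auto simp: P_def)
  hence jN: "j \<le> N" using card_mono[of "{1..N}" P] by (simp add: j_def)
  have M: "M = {N - j<..N}"
  proof (intro set_eqI)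
    fix i
    have "i \<in> M \<longleftrightarrow> 1 \<le> i \<and> i \<le> N \<and> N + 1 - i \<in> M'"
    proof (safe)
      assume "1 \<le> i" "i \<le> N" "N + 1 - i \<in> M'"
      then obtain c where "c \<in> M" "N + 1 - i = N + 1 - c" by (auto simp: M'_def)
      moreover from this have "i = c" using \<open>i \<le> N\<close> by (auto simp: M_def)
      ultimately show "i \<in> M" by simp
    qed (auto simp: M'_def M_def)
    thus "i \<in> M \<longleftrightarrow> i \<in> {N - j<..N}" using M' jN by auto
  qed
  have "card (P \<union> M) = 2 * j"
    using fin cM by (subst card_Un_disjoint) (auto simp: P_def M_def j_def)
  moreover have "card (P \<union> M) \<le> card {1..N}"
    by (rule card_mono) (auto simp: P_def M_def)
  ultimately have "2 * j \<le> N" by simp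
  moreover have "t = alcove_point N j"
  proof
    fix i
    have "t i = of_bool (i \<in> P) - of_bool (i \<in> M)"
      using range[of i] supp[of i] by (cases "i \<in> {1..N}") (auto simp: P_def M_def)
    thus "t i = alcove_point N j i" by (simp add: alcove_point_def P M)
  qed
  ultimately show "t \<in> alcove_point N ` {j. 2 * j \<le> N}" by blast
next
  fix t assume "t \<in> alcove_point N ` {j. 2 * j \<le> N}"
  then obtain j where j: "2 * j \<le> N" and t: "t = alcove_point N j" by blast
  have "t i = of_bool (i \<in> {1..j}) - of_bool (i \<in> {N - j<..N})" for i
    by (simp add: t alcove_point_def)
  hence "(\<Sum>i\<in>{1..N}. t i) = int (card ({1..N} \<inter> {1..j})) - int (card ({1..N} \<inter> {N - j<..N}))"
    by (simp only: sum_subtractf sum_of_bool_mem_eq finite_atLeastAtMost)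
  also have "{1..N} \<inter> {1..j} = {1..j}" using j by auto
  also have "{1..N} \<inter> {N - j<..N} = {N - j<..N}" by auto
  finally have "(\<Sum>i\<in>{1..N}. t i) = 0" using j by simp
  thus "t \<in> alcove_points (type_A N) 2"
    using j assms by (auto simp: alcove_points_type_A t alcove_point_def of_bool_def)
qed

lemma inj_on_alcove_point: "inj_on (alcove_point N) {j. 2 * j \<le> N}"
proof (rule linorder_inj_onI)
  fix a b :: nat assume "a < b" "b \<in> {j. 2 * j \<le> N}" "a \<in> {j. 2 * j \<le> N}"
  \<comment> \<open>Coordinate \<open>b\<close> separates the points: it is 1 on the right because
    \<open>b \<le> N - b\<close>, and at most 0 on the left because \<open>a < b\<close>.\<close>
  hence "alcove_point N a b \<noteq> alcove_point N b b"
    by (auto simp: alcove_point_def)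
  thus "alcove_point N a \<noteq> alcove_point N b" by metis
qed auto

section \<open>Walls, descents and order along the stacks\<close>

lemma sorted_wrt_map_upt_iff:
  fixes w :: "nat \<Rightarrow> 'a::linorder"
  shows "sorted_wrt (<) (map w [a..<b]) \<longleftrightarrow> (\<forall>i. a \<le> i \<and> Suc i < b \<longrightarrow> w i < w (Suc i))"
  unfolding sorted_wrt_iff_nth_Suc_transp[OF transp_on_less]
proof (safe, goal_cases)
  case (1 i)
  from 1(1)[rule_format, of "i - a"] 1(2,3) show ?case by simp
next
  case (2 i)
  thus ?case by simp
qed

lemma first_stack_initial_deck:
  "2 * j \<le> N \<Longrightarrow> first_stack (initial_deck N) j = [j + 1..<N - j + 1]"
  by (simp add: first_stack_def initial_deck_def take_upt drop_upt del: upt_Suc)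

lemma second_stack_initial_deck:
  "2 * j \<le> N \<Longrightarrow> second_stack (initial_deck N) j = [N - j + 1..<N + 1] @ [1..<j + 1]"
  by (simp add: second_stack_def initial_deck_def take_upt drop_upt del: upt_Suc)

text \<open>Adjacent coordinates agree except at the jumps after \<open>j\<close> and
  \<open>N - j\<close>, so the tight simple roots link neighbours inside the three blocks. For
  \<open>j > 0\<close> the tight root \<open>\<alpha>\<^sub>0\<close> links \<open>N\<close> to 1
  and thereby glues the last block to the first, in the order of the second stack.\<close>

lemma tight_disjoint_cdes_iff:
  assumes w: "w permutes {1..N}" and N: "N \<ge> 2" and j: "2 * j \<le> N"
  shows "tight_roots (type_A N) 2 (alcove_point N j) \<inter> cdes (type_A N) w = {} \<longleftrightarrow>
    sorted_wrt (<) (map w (first_stack (initial_deck N) j)) \<and>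
    sorted_wrt (<) (map w (second_stack (initial_deck N) j))"
proof -
  let ?t = "alcove_point N j"
  have inj: "inj w" using w by (rule permutes_inj)
  have tight: "tight_roots (type_A N) 2 ?t =
     (\<lambda>i. coord_root i (i + 1)) ` {i \<in> {1..<N}. j = 0 \<or> i \<noteq> j \<and> i \<noteq> N - j} \<union> (if j = 0 then {} else {coord_root N 1})"
  proof -
    have "?t i = ?t (Suc i) \<longleftrightarrow> j = 0 \<or> i \<noteq> j \<and> i \<noteq> N - j" if "i \<in> {1..<N}" for i
      using that j by (auto simp: alcove_point_def)
    moreover have "?t 1 - ?t N = 2 \<longleftrightarrow> j \<noteq> 0"
      using N j by (auto simp: alcove_point_def)
    ultimately show ?thesis
      using N by (auto simp: tight_roots_def simples_type_A affine_root_type_A highest_type_A pairing_coord_root)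
  qed
  \<comment> \<open>Since \<open>w\<close> is injective, not being a descent means a strict ascent;
    for \<open>\<alpha>\<^sub>0\<close> below, the ascent goes from \<open>N\<close> to 1.\<close>
  have cd1: "coord_root i (i + 1) \<in> cdes (type_A N) w \<longleftrightarrow> \<not> w i < w (Suc i)" if "i \<in> {1..<N}" for i
    using action_coord_root_negative_iff[OF w, of i "i + 1"] that inj_eq[OF inj, of i "Suc i"]
    by (auto simp: cdes_def ext_simples_def simples_type_A)
  have cd2: "coord_root N 1 \<in> cdes (type_A N) w \<longleftrightarrow> \<not> w N < w 1"
    using action_coord_root_negative_iff[OF w, of N 1] N inj_eq[OF inj, of N 1]
    by (auto simp: cdes_def ext_simples_def affine_root_type_A)
  have "tight_roots (type_A N) 2 ?t \<inter> cdes (type_A N) w = {} \<longleftrightarrow>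
      (\<forall>i\<in>{1..<N}. j = 0 \<or> i \<noteq> j \<and> i \<noteq> N - j \<longrightarrow> coord_root i (i + 1) \<notin> cdes (type_A N) w) \<and>
      (j = 0 \<or> coord_root N 1 \<notin> cdes (type_A N) w)"
  proof -
    have disjoint: "(f ` A \<union> B) \<inter> C = {} \<longleftrightarrow> (\<forall>x\<in>A. f x \<notin> C) \<and> B \<inter> C = {}"
      for f :: "nat \<Rightarrow> nat \<Rightarrow> int" and A B C
      by blast
    thus ?thesis unfolding tight disjoint by (cases "j = 0") auto
  qed
  also have "\<dots> \<longleftrightarrow> (\<forall>i\<in>{1..<N}. j = 0 \<or> i \<noteq> j \<and> i \<noteq> N - j \<longrightarrow> w i < w (Suc i)) \<and> (j = 0 \<or> w N < w 1)"
    by (intro conj_cong ball_cong imp_cong disj_cong refl) (simp_all only: cd1 cd2 not_not)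
  also have "\<dots> \<longleftrightarrow> (\<forall>i. j + 1 \<le> i \<and> Suc i < N - j + 1 \<longrightarrow> w i < w (Suc i)) \<and>
      (\<forall>i. N - j + 1 \<le> i \<and> Suc i < N + 1 \<longrightarrow> w i < w (Suc i)) \<and>
      (\<forall>i. 1 \<le> i \<and> Suc i < j + 1 \<longrightarrow> w i < w (Suc i)) \<and> (j = 0 \<or> w N < w 1)"
    (is "?L \<longleftrightarrow> ?R")
  proof
    assume L: ?L
    hence step: "w i < w (Suc i)" if "i \<in> {1..<N}" "j = 0 \<or> i \<noteq> j \<and> i \<noteq> N - j" for i
      using that by blast
    show ?R
      using j L[THEN conjunct2] by (intro conjI allI impI step) auto
  next
    assume R: ?R
    hence R': "j + 1 \<le> i \<Longrightarrow> Suc i < N - j + 1 \<Longrightarrow> w i < w (Suc i)"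
      "N - j + 1 \<le> i \<Longrightarrow> Suc i < N + 1 \<Longrightarrow> w i < w (Suc i)"
      "1 \<le> i \<Longrightarrow> Suc i < j + 1 \<Longrightarrow> w i < w (Suc i)" for i
      by blast+
    have "w i < w (Suc i)" if "i \<in> {1..<N}" "j = 0 \<or> i \<noteq> j \<and> i \<noteq> N - j" for i
    proof -
      have "i < j \<or> j + 1 \<le> i \<and> Suc i < N - j + 1 \<or> N - j + 1 \<le> i"
        using that by auto
      thus ?thesis using that(1) by (elim disjE conjE) (auto intro: R')
    qed
    thus ?L using R[THEN conjunct2, THEN conjunct2, THEN conjunct2] by (intro conjI ballI impI)
  qed
  also have "\<dots> \<longleftrightarrow> sorted_wrt (<) (map w [j + 1..<N - j + 1]) \<and>
      sorted_wrt (<) (map w ([N - j + 1..<N + 1] @ [1..<j + 1]))"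
  proof -
    \<comment> \<open>The junction of the two blocks contributes the comparison of
      \<open>w N\<close> with \<open>w 1\<close>; for \<open>j = 0\<close> both blocks are
      empty.\<close>
    have split: "sorted_wrt (<) (map w ([N - j + 1..<N + 1] @ [1..<j + 1])) \<longleftrightarrow>
      sorted_wrt (<) (map w [N - j + 1..<N + 1]) \<and> sorted_wrt (<) (map w [1..<j + 1]) \<and>
      (j = 0 \<or> w N < w 1)"
    proof (cases "j = 0")
      case False
      hence "[N - j + 1..<N + 1] \<noteq> []" "[1..<j + 1] \<noteq> []"
        "last (map w [N - j + 1..<N + 1]) = w N" "hd (map w [1..<j + 1]) = w 1"
        using N by (simp_all add: last_map hd_map del: upt_Suc)
      thus ?thesis
        using False
        unfolding map_append successively_conv_sorted_wrt[OF transp_on_less, symmetric]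
          successively_append_iff
        by (simp only: map_is_Nil_conv simp_thms)
    qed simp
    show ?thesis by (simp only: split sorted_wrt_map_upt_iff)
  qed
  finally show ?thesis
    by (simp only: first_stack_initial_deck[OF j] second_stack_initial_deck[OF j])
qed

text \<open>The sum over \<open>I\<close> counts the alcove points with no wall in the descent set,
  and these correspond injectively to the admissible \<open>j\<close>. The exponent is the rank
  \<open>N - 1\<close>.\<close>

lemma cellini_type_A_2:
  assumes w: "w permutes {1..N}" and N: "N \<ge> 2"
  shows "cellini (type_A N) 2 w = card {j. 2 * j \<le> N \<and>
    sorted_wrt (<) (map w (first_stack (initial_deck N) j)) \<and>
    sorted_wrt (<) (map w (second_stack (initial_deck N) j))} / 2 ^ (N - 1)"
proof -
  let ?C = "cdes (type_A N) w"
  have fin: "finite {j. 2 * j \<le> N}" by (rule finite_subset[of _ "{..N}"]) auto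
  have "(\<Sum>I \<in> Pow (ext_simples (type_A N) - ?C). cellini_count (type_A N) 2 I) =
      card {t \<in> alcove_points (type_A N) 2. tight_roots (type_A N) 2 t \<inter> ?C = {}}"
    by (rule sum_cellini_count[OF affine_root_notin_simples_type_A[OF N]])
       (use fin in \<open>simp_all add: simples_type_A alcove_points_type_A_2[OF N]\<close>)
  also have "{t \<in> alcove_points (type_A N) 2. tight_roots (type_A N) 2 t \<inter> ?C = {}} =
      alcove_point N ` {j. 2 * j \<le> N \<and>
        sorted_wrt (<) (map w (first_stack (initial_deck N) j)) \<and>
        sorted_wrt (<) (map w (second_stack (initial_deck N) j))}" (is "_ = _ ` ?J")
    using tight_disjoint_cdes_iff[OF w N] by (auto simp: alcove_points_type_A_2[OF N])
  also have "card \<dots> = card ?J"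
    by (rule card_image, rule inj_on_subset[OF inj_on_alcove_point]) auto
  finally have "(\<Sum>I \<in> Pow (ext_simples (type_A N) - ?C). real (cellini_count (type_A N) 2 I)) =
      real (card ?J)"
    by (simp flip: of_nat_sum)
  moreover have "w \<in> weyl (type_A N)" using w by (simp add: type_A_def)
  ultimately show ?thesis by (simp add: cellini_def card_simples_type_A)
qed

section \<open>The distribution of the shuffle\<close>

lemma set_first_stack: "2 * j \<le> N \<Longrightarrow> set (first_stack (initial_deck N) j) = {j<..N - j}"
  by (auto simp: first_stack_initial_deck)

lemma set_second_stack:
  "2 * j \<le> N \<Longrightarrow> set (second_stack (initial_deck N) j) = {1..j} \<union> {N - j<..N}"
  by (auto simp: second_stack_initial_deck)

lemma stacks_disjoint:
  "2 * j \<le> N \<Longrightarrow>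
    set (first_stack (initial_deck N) j) \<inter> set (second_stack (initial_deck N) j) = {}"
  by (auto simp: set_first_stack set_second_stack)

lemma stacks_cover:
  "2 * j \<le> N \<Longrightarrow>
    set (first_stack (initial_deck N) j) \<union> set (second_stack (initial_deck N) j) = {1..N}"
  by (auto simp: set_first_stack set_second_stack)

lemma card_shuffles_stacks:
  assumes "2 * j \<le> N"
  shows "card (shuffles (first_stack (initial_deck N) j) (second_stack (initial_deck N) j)) =
    N choose (2 * j)"
proof -
  have "length (first_stack (initial_deck N) j) = N - 2 * j"
    "length (second_stack (initial_deck N) j) = 2 * j"
    using assms by (simp_all add: first_stack_initial_deck second_stack_initial_deck del: upt_Suc)
  thus ?thesis
    using assms stacks_disjoint[OF assms]
    by (simp add: card_disjoint_shuffles binomial_symmetric[of "2 * j" N])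
qed

lemma shuffle_of_stacks:
  assumes "2 * j \<le> N"
    "deck \<in> shuffles (first_stack (initial_deck N) j) (second_stack (initial_deck N) j)"
  shows "length deck = N" "distinct deck" "set deck = {1..N}"
proof -
  let ?F = "first_stack (initial_deck N) j" and ?S = "second_stack (initial_deck N) j"
  have "distinct ?F" "distinct ?S"
    using assms(1) by (auto simp: first_stack_initial_deck second_stack_initial_deck)
  thus "distinct deck"
    using distinct_disjoint_shuffles[OF _ _ stacks_disjoint assms(2)] assms(1) by blast
  show "set deck = {1..N}"
    using set_shuffles[OF assms(2)] stacks_cover[OF assms(1)] by simp
  thus "length deck = N"
    using distinct_card[OF \<open>distinct deck\<close>] by simp
qed

section \<open>Decks as permutations\<close>

lemma deck_perm_map_upt:
  assumes "u permutes {1..N}"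
  shows "deck_perm (map u [1..<N + 1]) = u"
proof
  fix i
  show "deck_perm (map u [1..<N + 1]) i = u i"
    using permutes_not_in[OF assms, of i] by (auto simp: deck_perm_def simp del: upt_Suc)
qed

text \<open>Together with \<open>deck_perm_map_upt\<close> this makes \<open>deck_perm\<close>
  invertible on decks of known length: no information is lost in passing to permutations.\<close>

lemma map_deck_perm_upt: "map (deck_perm deck) [1..<length deck + 1] = deck"
  by (rule nth_equalityI) (auto simp: deck_perm_def simp del: upt_Suc)

lemma deck_perm_permutes:
  assumes "distinct deck" "set deck = {1..length deck}"
  shows "deck_perm deck permutes {1..length deck}"
proof (rule bij_imp_permutes)
  have "bij_betw ((!) deck) {..<length deck} {1..length deck}"
    using assms by (intro bij_betw_nth) auto
  moreover have "bij_betw (\<lambda>i. i - 1) {1..length deck} {..<length deck}"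
    by (rule bij_betw_byWitness[where f' = Suc]) auto
  ultimately have "bij_betw ((!) deck \<circ> (\<lambda>i. i - 1)) {1..length deck} {1..length deck}"
    by (rule bij_betw_trans[rotated])
  thus "bij_betw (deck_perm deck) {1..length deck} {1..length deck}"
    by (subst bij_betw_cong[where g = "(!) deck \<circ> (\<lambda>i. i - 1)"]) (auto simp: deck_perm_def)
qed (simp only: deck_perm_def if_False)

text \<open>An interleaving keeps the order of each stack, so positions, given by
  \<open>inv u\<close>, increase along both stacks. The inverse arising here is the one in the
  definition of \<open>x_2^{-1}\<close>.\<close>

lemma deck_perm_in_shuffles_iff:
  assumes "2 * j \<le> N"
  shows "u \<in> deck_perm ` shuffles (first_stack (initial_deck N) j) (second_stack (initial_deck N) j)
    \<longleftrightarrow> u permutes {1..N} \<and>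
      sorted_wrt (<) (map (inv u) (first_stack (initial_deck N) j)) \<and>
      sorted_wrt (<) (map (inv u) (second_stack (initial_deck N) j))"
    (is "_ \<in> deck_perm ` shuffles ?F ?S \<longleftrightarrow> _")
proof -
  let ?D = "map u [1..<N + 1]"
  have "u \<in> deck_perm ` shuffles ?F ?S \<longleftrightarrow> u permutes {1..N} \<and> ?D \<in> shuffles ?F ?S"
  proof
    assume "u \<in> deck_perm ` shuffles ?F ?S"
    then obtain deck where deck: "deck \<in> shuffles ?F ?S" "u = deck_perm deck" by blast
    note d = shuffle_of_stacks[OF assms deck(1)]
    show "u permutes {1..N} \<and> ?D \<in> shuffles ?F ?S"
      using deck d deck_perm_permutes[of deck] map_deck_perm_upt[of deck] by simp
  next
    assume "u permutes {1..N} \<and> ?D \<in> shuffles ?F ?S"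
    thus "u \<in> deck_perm ` shuffles ?F ?S"
      using deck_perm_map_upt by (metis image_eqI)
  qed
  moreover have "?D \<in> shuffles ?F ?S \<longleftrightarrow>
      sorted_wrt (<) (map (inv u) ?F) \<and> sorted_wrt (<) (map (inv u) ?S)" if u: "u permutes {1..N}"
  proof -
    have "set ?D = {1..N}"
      using permutes_image[OF u] by (simp add: atLeastLessThanSuc_atLeastAtMost del: upt_Suc)
    \<comment> \<open>The two stacks partition \<open>{1..N}\<close>, so a card of the deck outside
      the first stack belongs to the second.\<close>
    hence "filter (\<lambda>z. z \<notin> set ?F) ?D = filter (\<lambda>z. z \<in> set ?S) ?D"
      using stacks_disjoint[OF assms] stacks_cover[OF assms] by (intro filter_cong) blast+
    hence "?D \<in> shuffles ?F ?S \<longleftrightarrow>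
        filter (\<lambda>z. z \<in> set ?F) ?D = ?F \<and> filter (\<lambda>z. z \<in> set ?S) ?D = ?S"
      by (simp only: in_shuffles_iff_filter[OF stacks_disjoint[OF assms]])
    thus ?thesis
      using filter_eq_iff_sorted_positions[OF u] stacks_cover[OF assms] by blast
  qed
  ultimately show ?thesis by blast
qed

section \<open>Comparison of the coefficients\<close>

lemma finite_pile_indices: "finite {j::nat. 2 * j \<le> N}"
  by (rule finite_subset[of _ "{..N}"]) auto

lemma pmf_shuffle_perm_uniform:
  assumes "N \<ge> 1"
  shows "pmf (shuffle_perm_pmf riffle_uniform N) u =
    (if u permutes {1..N} then card {j. 2 * j \<le> N \<and>
      sorted_wrt (<) (map (inv u) (first_stack (initial_deck N) j)) \<and>
      sorted_wrt (<) (map (inv u) (second_stack (initial_deck N) j))} / 2 ^ (N - 1) else 0)"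
proof -
  let ?J = "{j. 2 * j \<le> N}"
  let ?X = "\<lambda>j. shuffles (first_stack (initial_deck N) j) (second_stack (initial_deck N) j)"
  have X: "pmf (map_pmf deck_perm (pmf_of_set (?X j))) u =
      of_bool (u \<in> deck_perm ` ?X j) / (N choose (2 * j))" if j: "2 * j \<le> N" for j
  proof -
    have inj: "inj_on deck_perm (?X j)"
      using map_deck_perm_upt shuffle_of_stacks(1)[OF j] by (intro inj_onI) metis
    hence "map_pmf deck_perm (pmf_of_set (?X j)) = pmf_of_set (deck_perm ` ?X j)"
      by (intro map_pmf_of_set_inj) auto
    moreover have "?X j \<noteq> {}"
      using splice_in_shuffles by blast
    ultimately show ?thesis
      by (simp add: pmf_of_set card_image[OF inj] card_shuffles_stacks[OF j] indicator_def)
  qed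
  have "pmf (shuffle_perm_pmf riffle_uniform N) u =
      (\<integral>j. pmf (map_pmf deck_perm (pmf_of_set (?X j))) u \<partial>pile_index_pmf N)"
    by (simp add: shuffle_perm_pmf_def shuffle_pmf_def riffle_uniform_def map_bind_pmf pmf_bind)
  also have "\<dots> = (\<Sum>j\<in>?J. pmf (map_pmf deck_perm (pmf_of_set (?X j))) u * pmf (pile_index_pmf N) j)"
    by (rule integral_measure_pmf_real[OF finite_pile_indices])
       (use assms in \<open>auto simp: set_pmf_eq pmf_pile_index split: if_splits\<close>)
  \<comment> \<open>The number of interleavings equals the binomial coefficient in the probability
    of \<open>j\<close>, so every \<open>j\<close> that can produce \<open>u\<close> contributes the
    same amount.\<close>
  also have "\<dots> = (\<Sum>j\<in>?J. of_bool (u \<in> deck_perm ` ?X j) / 2 ^ (N - 1))"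
    by (rule sum.cong) (simp_all add: X pmf_pile_index[OF assms])
  also have "\<dots> = card {j \<in> ?J. u \<in> deck_perm ` ?X j} / 2 ^ (N - 1)"
    by (simp add: sum_divide_distrib[symmetric] sum.If_cases of_bool_def finite_pile_indices Int_def)
  also have "{j \<in> ?J. u \<in> deck_perm ` ?X j} = (if u permutes {1..N} then {j. 2 * j \<le> N \<and>
      sorted_wrt (<) (map (inv u) (first_stack (initial_deck N) j)) \<and>
      sorted_wrt (<) (map (inv u) (second_stack (initial_deck N) j))} else {})"
    using deck_perm_in_shuffles_iff by auto
  finally show ?thesis by simp
qed

lemma group_algebra_inv_apply:
  "group_algebra_inv N x w = (if w permutes {1..N} then x (inv w) else 0)"
proof -
  have "{u. u permutes {1..N} \<and> inv u = w} = (if w permutes {1..N} then {inv w} else {})"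
    by (auto simp: permutes_inv permutes_inv_inv)
  thus ?thesis by (simp add: group_algebra_inv_def)
qed

lemma shuffle_perm_by_dropping_eq_uniform:
  assumes "N \<ge> 1"
  shows "shuffle_perm_pmf riffle_by_dropping N = shuffle_perm_pmf riffle_uniform N"
proof -
  have "shuffle_pmf riffle_by_dropping N = shuffle_pmf riffle_uniform N"
    unfolding shuffle_pmf_def
  proof (rule bind_pmf_cong[OF refl])
    fix j assume "j \<in> set_pmf (pile_index_pmf N)"
    hence "2 * j \<le> N" using assms by (auto simp: set_pmf_eq pmf_pile_index split: if_splits)
    thus "riffle_by_dropping (first_stack (initial_deck N) j) (second_stack (initial_deck N) j) =
        riffle_uniform (first_stack (initial_deck N) j) (second_stack (initial_deck N) j)"
      by (intro riffle_by_dropping_eq_uniform stacks_disjoint)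
  qed
  thus ?thesis by (simp add: shuffle_perm_pmf_def)
qed

theorem proposition7:
  fixes n :: nat
  assumes "n \<ge> 1"
  shows "\<forall>N \<in> {2 * n, 2 * n + 1}.
           group_algebra_inv N (cellini (type_A N) 2) = pmf (shuffle_perm_pmf riffle_by_dropping N) \<and>
           group_algebra_inv N (cellini (type_A N) 2) = pmf (shuffle_perm_pmf riffle_uniform N)"
proof
  fix N assume "N \<in> {2 * n, 2 * n + 1}"
  \<comment> \<open>Both parities are treated at once; \<open>N \<ge> 2\<close> guarantees that
    \<open>\<alpha>\<^sub>0\<close> is a root outside the simple ones.\<close>
  hence N: "N \<ge> 2" using assms by auto
  have "group_algebra_inv N (cellini (type_A N) 2) = pmf (shuffle_perm_pmf riffle_uniform N)"
  proof
    fix u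
    show "group_algebra_inv N (cellini (type_A N) 2) u = pmf (shuffle_perm_pmf riffle_uniform N) u"
      using N by (simp add: group_algebra_inv_apply cellini_type_A_2 permutes_inv
          pmf_shuffle_perm_uniform)
  qed
  thus "group_algebra_inv N (cellini (type_A N) 2) = pmf (shuffle_perm_pmf riffle_by_dropping N) \<and>
      group_algebra_inv N (cellini (type_A N) 2) = pmf (shuffle_perm_pmf riffle_uniform N)"
    using N by (simp add: shuffle_perm_by_dropping_eq_uniform)
qed

end
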